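(* There is an algorithm which, given an unambiguous context-free grammar $G$ in Chomsky form with $n$ nonterminals over a finite alphabet $\Sigma$, an HMM $A'$ over $\Sigma$ with $n'$ states, and an integer $L>0$, computes exactly $f_{A'}(L_G\cap\Sigma^L)$ using $$O\big(|G|\cdot n'^2\cdot\max(n'\cdot L^2,\ |\Sigma|)\big)$$ additions and multiplications of real numbers, and storing $O(n'^2\cdot n\cdot L)$ real numbers for intermediate results.
   Context: CFG: a context-free grammar in Chomsky form has nonterminals $[n]=\{1,\dots,n\}$, terminal alphabet $\Sigma$, initial nonterminal $S\in[n]$, and a finite set $R$ of production rules of the form $i\to jk$ or $i\to\sigma$ with $i,j,k\in[n]$, $\sigma\in\Sigma$. Its size $|G|$ is the number of production rules. For $w\in\Sigma^*$, $f_G(w)$ is the number of derivation trees of $G$ with root labelled $S$ and yield $w$; $L_G=\{w: f_G(w)\ge1\}$. $G$ is unambiguous if $f_G(w)\le1$ for all $w$. HMM: $A'=\langle[n'],\pi',\{A'_\sigma\}_{\sigma\in\Sigma}\rangle$ with $\pi'$ a probability distribution over $[n']$ and entrywise non-negative matrices $A'_\sigma\in\mathbb{R}^{n'\times n'}$ such that $\sum_\sigma A'_\sigma$ has all row sums equal to $1$. For $w=w_1\cdots w_m$ (letters), $f_{A'}(w)=\pi'^TA'_{w_1}\cdots A'_{w_m}e_{[n']}$, where $e_{[n']}$ is the all-ones vector; for each $m$ this is a probability distribution on $\Sigma^m$. For a set $X\subseteq\Sigma^*$, $f_{A'}(X)=\sum_{w\in X}f_{A'}(w)$. *)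

theory Defs
  imports Complex_Main "Jordan_Normal_Form.Matrix"
begin

section \<open>Context-free grammars in Chomsky form\<close>

datatype 'a rule = Binary nat nat nat | Terminal nat 'a

record 'a cfg =
  nonterms :: nat
  start :: nat
  rules :: "'a rule set"

definition chomsky_cfg :: "'a set \<Rightarrow> 'a cfg \<Rightarrow> bool" where
  "chomsky_cfg \<Sigma> G \<longleftrightarrow>
     start G \<in> {1..nonterms G} \<and> finite (rules G) \<and>
     (\<forall>r \<in> rules G. case r of
        Binary i j k \<Rightarrow> {i, j, k} \<subseteq> {1..nonterms G}
      | Terminal i a \<Rightarrow> i \<in> {1..nonterms G} \<and> a \<in> \<Sigma>)"

definition cfg_size :: "'a cfg \<Rightarrow> nat" where
  "cfg_size G = card (rules G)"

text \<open>\<open>Leaf i a\<close> is a node labelled \<open>i\<close> whose only child is a leaf labelled \<open>a\<close>.\<close>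

datatype 'a tree = Leaf nat 'a | Node nat "'a tree" "'a tree"

fun tree_root :: "'a tree \<Rightarrow> nat" where
  "tree_root (Leaf i a) = i"
| "tree_root (Node i t u) = i"

fun tree_yield :: "'a tree \<Rightarrow> 'a list" where
  "tree_yield (Leaf i a) = [a]"
| "tree_yield (Node i t u) = tree_yield t @ tree_yield u"

fun derivation_tree :: "'a cfg \<Rightarrow> 'a tree \<Rightarrow> bool" where
  "derivation_tree G (Leaf i a) \<longleftrightarrow> Terminal i a \<in> rules G"
| "derivation_tree G (Node i t u) \<longleftrightarrow>
     Binary i (tree_root t) (tree_root u) \<in> rules G \<and> derivation_tree G t \<and> derivation_tree G u"

definition num_derivations :: "'a cfg \<Rightarrow> 'a list \<Rightarrow> nat" where
  "num_derivations G w = card {t. derivation_tree G t \<and> tree_root t = start G \<and> tree_yield t = w}"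

text \<open>The cardinality in \<^const>\<open>num_derivations\<close> is never the default value for infinite sets.\<close>

lemma tree_yield_nonempty: "tree_yield t \<noteq> []"
  by (induction t) auto

lemma finite_derivation_trees_upto:
  assumes fin: "finite (rules G)"
  shows "finite {t. derivation_tree G t \<and> length (tree_yield t) \<le> m}"
proof (induction m)
  case 0
  then show ?case by (simp add: tree_yield_nonempty)
next
  case (Suc m)
  let ?T = "{t. derivation_tree G t \<and> length (tree_yield t) \<le> m}"
  let ?leaf = "\<lambda>r. case r of Terminal i a \<Rightarrow> Leaf i a | Binary i j k \<Rightarrow> undefined"
  let ?node = "\<lambda>(r, t, u). case r of Binary i j k \<Rightarrow> Node i t u | Terminal i a \<Rightarrow> undefined"
  have "t \<in> ?leaf ` rules G \<union> ?node ` (rules G \<times> ?T \<times> ?T)"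
    if t: "derivation_tree G t" "length (tree_yield t) \<le> Suc m" for t
  proof (cases t)
    case (Leaf i a)
    then show ?thesis using t by (force intro!: image_eqI[where x = "Terminal i a"])
  next
    case (Node i u v)
    have "length (tree_yield u) \<noteq> 0" "length (tree_yield v) \<noteq> 0"
      by (simp_all add: tree_yield_nonempty)
    moreover have "length (tree_yield u) + length (tree_yield v) \<le> Suc m" using t Node by simp
    ultimately have "length (tree_yield u) \<le> m" "length (tree_yield v) \<le> m" by linarith+
    then have "(Binary i (tree_root u) (tree_root v), u, v) \<in> rules G \<times> ?T \<times> ?T"
      using t Node by auto
    moreover have "t = ?node (Binary i (tree_root u) (tree_root v), u, v)" using Node by simp
    ultimately show ?thesis by blast
  qed
  then have "{t. derivation_tree G t \<and> length (tree_yield t) \<le> Suc m}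
      \<subseteq> ?leaf ` rules G \<union> ?node ` (rules G \<times> ?T \<times> ?T)" by blast
  then show ?case by (rule finite_subset) (use fin Suc in simp)
qed

lemma finite_derivations:
  assumes "finite (rules G)"
  shows "finite {t. derivation_tree G t \<and> tree_root t = start G \<and> tree_yield t = w}"
  by (rule finite_subset[OF _ finite_derivation_trees_upto[OF assms, of "length w"]]) auto

definition lang :: "'a cfg \<Rightarrow> 'a list set" where
  "lang G = {w. num_derivations G w \<ge> 1}"

definition unambiguous :: "'a cfg \<Rightarrow> bool" where
  "unambiguous G \<longleftrightarrow> (\<forall>w. num_derivations G w \<le> 1)"

definition words :: "'a set \<Rightarrow> nat \<Rightarrow> 'a list set" where
  "words \<Sigma> m = {w. set w \<subseteq> \<Sigma> \<and> length w = m}"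


section \<open>Hidden Markov models\<close>

record 'a hmm =
  states :: nat
  init_dist :: "real vec"
  trans :: "'a \<Rightarrow> real mat"

definition hmm :: "'a set \<Rightarrow> 'a hmm \<Rightarrow> bool" where
  "hmm \<Sigma> A \<longleftrightarrow>
     init_dist A \<in> carrier_vec (states A) \<and>
     (\<forall>p < states A. init_dist A $ p \<ge> 0) \<and>
     (\<Sum>p < states A. init_dist A $ p) = 1 \<and>
     (\<forall>a \<in> \<Sigma>. trans A a \<in> carrier_mat (states A) (states A) \<and>
        (\<forall>p < states A. \<forall>q < states A. trans A a $$ (p, q) \<ge> 0)) \<and>
     (\<forall>p < states A. (\<Sum>q < states A. \<Sum>a \<in> \<Sigma>. trans A a $$ (p, q)) = 1)"

definition hmm_prob :: "'a hmm \<Rightarrow> 'a list \<Rightarrow> real" where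
  "hmm_prob A w =
     init_dist A \<bullet> (foldr (\<lambda>a M. trans A a * M) w (1\<^sub>m (states A)) *\<^sub>v vec (states A) (\<lambda>_. 1))"

text \<open>Only meaningful for finite \<open>X\<close>, such as sets of words of a fixed length.\<close>

definition hmm_prob_set :: "'a hmm \<Rightarrow> 'a list set \<Rightarrow> real" where
  "hmm_prob_set A X = (\<Sum>w \<in> X. hmm_prob A w)"


section \<open>A random access machine over the reals\<close>

text \<open>
  Algorithms are programs of a WHILE language that works on an integer memory (natural numbers,
  initially all 0) and a real memory (initially empty), both addressed indirectly, and that reads
  one list of natural numbers and one list of reals as input. Control flow and addresses depend on
  integers only. The operations that produce new real numbers are addition and multiplication,
  and these are what \<open>ops\<close> counts; loading an input or one of the constants 0, 1 is
  free. Real cells are never released, so the domain of the real memory at the end of a run is the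
  set of all cells that were used at any time. The input lists are read-only and not part of it.
\<close>

datatype iexp =
    IConst nat
  | ICell iexp
  | IInput iexp
  | IAdd iexp iexp
  | ISub iexp iexp
  | IMul iexp iexp

datatype bexp = Less iexp iexp | BNot bexp | BAnd bexp bexp

datatype rarg = RZero | ROne | RCell iexp | RInput iexp

datatype com =
    Skip
  | ISet iexp iexp
  | RSet iexp rarg
  | RAdd iexp rarg rarg
  | RMul iexp rarg rarg
  | Seq com com
  | Cond bexp com com
  | While bexp com

record state =
  imem :: "nat \<Rightarrow> nat"
  rmem :: "nat \<rightharpoonup> real"
  ops :: nat

definition initial_state :: state where
  "initial_state = \<lparr>imem = (\<lambda>_. 0), rmem = Map.empty, ops = 0\<rparr>"

fun ival :: "nat list \<Rightarrow> state \<Rightarrow> iexp \<Rightarrow> nat" where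
  "ival ns s (IConst c) = c"
| "ival ns s (ICell e) = imem s (ival ns s e)"
| "ival ns s (IInput e) = (let x = ival ns s e in if x < length ns then ns ! x else 0)"
| "ival ns s (IAdd e f) = ival ns s e + ival ns s f"
| "ival ns s (ISub e f) = ival ns s e - ival ns s f"
| "ival ns s (IMul e f) = ival ns s e * ival ns s f"

fun bval :: "nat list \<Rightarrow> state \<Rightarrow> bexp \<Rightarrow> bool" where
  "bval ns s (Less e f) \<longleftrightarrow> ival ns s e < ival ns s f"
| "bval ns s (BNot b) \<longleftrightarrow> \<not> bval ns s b"
| "bval ns s (BAnd b c) \<longleftrightarrow> bval ns s b \<and> bval ns s c"

fun rval :: "nat list \<Rightarrow> real list \<Rightarrow> state \<Rightarrow> rarg \<Rightarrow> real option" where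
  "rval ns xs s RZero = Some 0"
| "rval ns xs s ROne = Some 1"
| "rval ns xs s (RCell e) = rmem s (ival ns s e)"
| "rval ns xs s (RInput e) = (let x = ival ns s e in if x < length xs then Some (xs ! x) else None)"

text \<open>A run gets stuck when it reads an undefined real cell or a nonexistent real input.\<close>

inductive exec :: "nat list \<Rightarrow> real list \<Rightarrow> com \<Rightarrow> state \<Rightarrow> state \<Rightarrow> bool"
  for ns :: "nat list" and xs :: "real list" where
  exec_Skip: "exec ns xs Skip s s"
| exec_ISet: "exec ns xs (ISet d e) s (s\<lparr>imem := (imem s)(ival ns s d := ival ns s e)\<rparr>)"
| exec_RSet: "rval ns xs s a = Some x \<Longrightarrow>
    exec ns xs (RSet d a) s (s\<lparr>rmem := (rmem s)(ival ns s d \<mapsto> x)\<rparr>)"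
| exec_RAdd: "rval ns xs s a = Some x \<Longrightarrow> rval ns xs s b = Some y \<Longrightarrow>
    exec ns xs (RAdd d a b) s (s\<lparr>rmem := (rmem s)(ival ns s d \<mapsto> x + y), ops := ops s + 1\<rparr>)"
| exec_RMul: "rval ns xs s a = Some x \<Longrightarrow> rval ns xs s b = Some y \<Longrightarrow>
    exec ns xs (RMul d a b) s (s\<lparr>rmem := (rmem s)(ival ns s d \<mapsto> x * y), ops := ops s + 1\<rparr>)"
| exec_Seq: "exec ns xs c s t \<Longrightarrow> exec ns xs d t u \<Longrightarrow> exec ns xs (Seq c d) s u"
| exec_CondTrue: "bval ns s b \<Longrightarrow> exec ns xs c s t \<Longrightarrow> exec ns xs (Cond b c d) s t"
| exec_CondFalse: "\<not> bval ns s b \<Longrightarrow> exec ns xs d s t \<Longrightarrow> exec ns xs (Cond b c d) s t"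
| exec_WhileFalse: "\<not> bval ns s b \<Longrightarrow> exec ns xs (While b c) s s"
| exec_WhileTrue: "bval ns s b \<Longrightarrow> exec ns xs c s t \<Longrightarrow> exec ns xs (While b c) t u \<Longrightarrow>
    exec ns xs (While b c) s u"

inductive_cases exec_SkipE: "exec ns xs Skip s t"
inductive_cases exec_ISetE: "exec ns xs (ISet d e) s t"
inductive_cases exec_RSetE: "exec ns xs (RSet d a) s t"
inductive_cases exec_RAddE: "exec ns xs (RAdd d a b) s t"
inductive_cases exec_RMulE: "exec ns xs (RMul d a b) s t"
inductive_cases exec_SeqE: "exec ns xs (Seq c d) s t"
inductive_cases exec_CondE: "exec ns xs (Cond b c d) s t"
inductive_cases exec_WhileE: "exec ns xs (While b c) s t"

lemma exec_deterministic: "exec ns xs c s t \<Longrightarrow> exec ns xs c s u \<Longrightarrow> u = t"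
proof (induction arbitrary: u rule: exec.induct)
  case exec_Skip
  from exec_Skip.prems show ?case by (rule exec_SkipE)
next
  case exec_ISet
  from exec_ISet.prems show ?case by (rule exec_ISetE)
next
  case exec_RSet
  from exec_RSet.prems show ?case by (rule exec_RSetE) (use exec_RSet.hyps in simp)
next
  case exec_RAdd
  from exec_RAdd.prems show ?case by (rule exec_RAddE) (use exec_RAdd.hyps in simp)
next
  case exec_RMul
  from exec_RMul.prems show ?case by (rule exec_RMulE) (use exec_RMul.hyps in simp)
next
  case exec_Seq
  from exec_Seq.prems show ?case by (rule exec_SeqE) (use exec_Seq.IH in blast)
next
  case exec_CondTrue
  from exec_CondTrue.prems show ?case
    by (rule exec_CondE) (use exec_CondTrue.hyps exec_CondTrue.IH in blast)+
next
  case exec_CondFalse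
  from exec_CondFalse.prems show ?case
    by (rule exec_CondE) (use exec_CondFalse.hyps exec_CondFalse.IH in blast)+
next
  case exec_WhileFalse
  from exec_WhileFalse.prems show ?case
    by (rule exec_WhileE) (use exec_WhileFalse.hyps in blast)+
next
  case exec_WhileTrue
  from exec_WhileTrue.prems show ?case
    by (rule exec_WhileE) (use exec_WhileTrue.hyps exec_WhileTrue.IH in blast)+
qed

lemma exec_finite_dom: "exec ns xs c s t \<Longrightarrow> finite (dom (rmem s)) \<Longrightarrow> finite (dom (rmem t))"
  by (induction rule: exec.induct) auto

lemma exec_dom_mono: "exec ns xs c s t \<Longrightarrow> dom (rmem s) \<subseteq> dom (rmem t)"
  by (induction rule: exec.induct) auto

definition cells_used :: "state \<Rightarrow> nat" where
  "cells_used s = card (dom (rmem s))"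


section \<open>Input format\<close>

text \<open>
  The alphabet and the rule set are presented as lists \<open>as\<close> and \<open>rs\<close> without repetitions, in any
  order; a letter is represented by its position in \<open>as\<close>. Each rule takes four numbers.
\<close>

definition letter_index :: "'a list \<Rightarrow> 'a \<Rightarrow> nat" where
  "letter_index as a = length (takeWhile (\<lambda>b. b \<noteq> a) as)"

fun encode_rule :: "'a list \<Rightarrow> 'a rule \<Rightarrow> nat list" where
  "encode_rule as (Binary i j k) = [0, i, j, k]"
| "encode_rule as (Terminal i a) = [1, i, letter_index as a, 0]"

definition nat_input :: "'a list \<Rightarrow> 'a cfg \<Rightarrow> 'a rule list \<Rightarrow> 'a hmm \<Rightarrow> nat \<Rightarrow> nat list" where
  "nat_input as G rs A L =
     [nonterms G, start G, length as, length rs, states A, L] @ concat (map (encode_rule as) rs)"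

definition real_input :: "'a list \<Rightarrow> 'a hmm \<Rightarrow> real list" where
  "real_input as A =
     map (\<lambda>p. init_dist A $ p) [0..<states A] @
     concat (map (\<lambda>a. concat (map (\<lambda>p. map (\<lambda>q. trans A a $$ (p, q)) [0..<states A])
       [0..<states A])) as)"

end

(*
  CYK dynamic programming, with matrices instead of truth values: the table stores, for each
  nonterminal i and length l, the matrix sum of A_w over all derivation trees with root i and
  yield w of length l. A binary rule i -> jk contributes the products of the tables of j and k over
  all splittings of l. Unambiguity turns the sum over trees with root S into the sum over L_G. Every
  arithmetic step of the program has the shape "cell += x * y", so the effect of a nest of loops is
  simply the sum of the contributions of its iterations.
*)
theory Submission
  imports Defs
begin

section \<open>Reasoning about programs\<close>

text \<open>The obstacle is that the loops read and write the same table. Stratification by length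
  resolves it: filling layer \<open>l\<close> reads only layers below \<open>l\<close>, which an
  invariant keeps fixed, so every product is a constant known in advance, and the order of the rules
  within a layer does not matter. Accumulation presupposes cells that are defined and hold 0.
  Loading zeros is free, so the whole table is allocated first; the set of cells in use never
  changes afterwards and can be counted exactly. Each accumulation step costs two operations. A rule
  costs at most \<open>2 * L * m ^ 3\<close> per layer, where \<open>m\<close> is the number of
  states, and there are \<open>L\<close> layers. The final weighted sum adds
  \<open>2 * m ^ 2\<close>.\<close>

lemma ival_cong: "imem s = imem s' \<Longrightarrow> ival ns s e = ival ns s' e"
  by (induction e) auto

lemma ival_rmem_ops [simp]:
  "ival ns (s\<lparr>rmem := m\<rparr>) e = ival ns s e"
  "ival ns (s\<lparr>rmem := m, ops := c\<rparr>) e = ival ns s e"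
  by (rule ival_cong, simp)+

definition For :: "nat \<Rightarrow> iexp \<Rightarrow> com \<Rightarrow> com" where
  "For x e c = Seq (ISet (IConst x) (IConst 0))
     (While (Less (ICell (IConst x)) e)
       (Seq c (ISet (IConst x) (IAdd (ICell (IConst x)) (IConst 1)))))"

text \<open>A total-correctness rule. The guard re-evaluates \<open>e\<close> in every round, so the
  invariant must determine its value, also for \<open>k = N\<close>. The counter is reset and
  incremented outside the body, hence the premise \<open>frame\<close>.\<close>

lemma For_rule:
  assumes bound: "\<And>k s. k \<le> N \<Longrightarrow> Inv k s \<Longrightarrow> ival ns s e = N"
    and body: "\<And>k s. k < N \<Longrightarrow> Inv k s \<Longrightarrow> imem s x = k \<Longrightarrow>
      \<exists>t. exec ns xs c s t \<and> imem t x = k \<and> Inv (Suc k) t"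
    and frame: "\<And>k s v. Inv k s \<Longrightarrow> Inv k (s\<lparr>imem := (imem s)(x := v)\<rparr>)"
    and init: "Inv 0 s"
  shows "\<exists>t. exec ns xs (For x e c) s t \<and> Inv N t"
proof -
  let ?c = "Seq c (ISet (IConst x) (IAdd (ICell (IConst x)) (IConst 1)))"
  let ?b = "Less (ICell (IConst x)) e"
  have loop: "\<exists>t. exec ns xs (While ?b ?c) s t \<and> Inv N t"
    if "k \<le> N" "Inv k s" "imem s x = k" for k s
    using that
  \<comment> \<open>The induction runs downwards from \<open>N\<close>: after one iteration at
    \<open>k\<close>, what remains is the loop entered at \<open>Suc k\<close>.\<close>
  proof (induction k arbitrary: s rule: inc_induct)
    case base
    then have "\<not> bval ns s ?b" using bound[of N s] by simp
    then show ?case using exec_WhileFalse base by blast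
  next
    case (step k)
    then have b: "bval ns s ?b" using bound[of k s] by simp
    obtain t where t: "exec ns xs c s t" "imem t x = k" "Inv (Suc k) t"
      using body step by blast
    let ?t = "t\<lparr>imem := (imem t)(x := Suc k)\<rparr>"
    have "exec ns xs ?c s ?t"
      using exec_Seq[OF t(1) exec_ISet[of ns xs "IConst x" "IAdd (ICell (IConst x)) (IConst 1)" t]]
        t(2) by simp
    moreover obtain u where "exec ns xs (While ?b ?c) ?t u" "Inv N u"
      using step.IH[of ?t] frame[OF t(3)] by auto
    ultimately show ?case using exec_WhileTrue[OF b] by blast
  qed
  let ?s = "s\<lparr>imem := (imem s)(x := 0)\<rparr>"
  obtain t where "exec ns xs (While ?b ?c) ?s t" "Inv N t"
    using loop[of 0 ?s] frame[OF init] by auto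
  then show ?thesis
    unfolding For_def
    using exec_Seq[OF exec_ISet[of ns xs "IConst x" "IConst 0" s]] by auto
qed

text \<open>\<open>vs\<close> lists the counters of the enclosing loops, outermost first. A loop at
  depth \<open>length vs\<close> uses the cell of that number, so nested loops never share a
  counter.\<close>

definition registers :: "nat list \<Rightarrow> state \<Rightarrow> bool" where
  "registers vs s \<longleftrightarrow> map (imem s) [0..<length vs] = vs"

lemma registers_append:
  "registers (vs @ [k]) s \<longleftrightarrow> registers vs s \<and> imem s (length vs) = k"
  by (auto simp: registers_def)

lemma registers_frame:
  "registers vs (s\<lparr>imem := (imem s)(length vs := v)\<rparr>) \<longleftrightarrow> registers vs s"
proof -
  have "map (imem (s\<lparr>imem := (imem s)(length vs := v)\<rparr>)) [0..<length vs] =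
      map (imem s) [0..<length vs]"
    by (rule map_cong) auto
  then show ?thesis by (simp only: registers_def)
qed

text \<open>
  \<open>accumulates ns xs J vs c g K\<close>: with the first integer cells set to \<open>vs\<close>, the command \<open>c\<close> adds
  \<open>g a\<close> to every real cell \<open>a\<close> except the scratch cell 1, at the cost of at most \<open>K\<close> operations.
\<close>

definition accumulates :: "nat list \<Rightarrow> real list \<Rightarrow> ((nat \<rightharpoonup> real) \<Rightarrow> bool) \<Rightarrow> nat list \<Rightarrow> com \<Rightarrow>
    (nat \<Rightarrow> real) \<Rightarrow> nat \<Rightarrow> bool" where
  "accumulates ns xs J vs c g K \<longleftrightarrow> (\<forall>s. J (rmem s) \<and> registers vs s \<longrightarrow>
     (\<exists>t. exec ns xs c s t \<and> J (rmem t) \<and> registers vs t \<and>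
        (\<forall>a. a \<noteq> 1 \<longrightarrow> rmem t a = map_option (\<lambda>x. x + g a) (rmem s a)) \<and>
        ops t \<le> ops s + K))"

text \<open>The contribution \<open>g k\<close> is fixed before the loop starts and cannot depend on
  the memory that an iteration meets. Contributions therefore add up, and a nest of loops yields a
  nested sum.\<close>

lemma accumulates_For:
  assumes x: "x = length vs"
    and bound: "\<And>s. J (rmem s) \<Longrightarrow> registers vs s \<Longrightarrow> ival ns s e = N"
    and body: "\<And>k. k < N \<Longrightarrow> accumulates ns xs J (vs @ [k]) c (g k) K"
  shows "accumulates ns xs J vs (For x e c) (\<lambda>a. \<Sum>k<N. g k a) (N * K)"
  unfolding accumulates_def
proof (intro allI impI, elim conjE)
  fix s assume s: "J (rmem s)" "registers vs s"
  define Inv where "Inv k t \<longleftrightarrow> J (rmem t) \<and> registers vs t \<and>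
     (\<forall>a. a \<noteq> 1 \<longrightarrow> rmem t a = map_option (\<lambda>x. x + (\<Sum>k<k. g k a)) (rmem s a)) \<and>
     ops t \<le> ops s + k * K" for k t
  have "\<exists>t. exec ns xs (For x e c) s t \<and> Inv N t"
  proof (rule For_rule)
    show "ival ns t e = N" if "Inv k t" for k t
      using that bound by (auto simp: Inv_def)
    show "Inv k (t\<lparr>imem := (imem t)(x := v)\<rparr>)" if "Inv k t" for k t v
      using that by (auto simp: Inv_def x registers_frame)
    show "Inv 0 s" using s by (simp add: Inv_def option.map_ident)
    show "\<exists>u. exec ns xs c t u \<and> imem u x = k \<and> Inv (Suc k) u"
      if k: "k < N" and t: "Inv k t" "imem t x = k" for k t
    proof -
      have "J (rmem t)" "registers (vs @ [k]) t"
        using t by (auto simp: Inv_def registers_append x)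
      then obtain u where u: "exec ns xs c t u" "J (rmem u)" "registers (vs @ [k]) u"
        "\<And>a. a \<noteq> 1 \<Longrightarrow> rmem u a = map_option (\<lambda>x. x + g k a) (rmem t a)" "ops u \<le> ops t + K"
        using body[OF k] unfolding accumulates_def by blast
      have "rmem u a = map_option (\<lambda>x. x + (\<Sum>k<Suc k. g k a)) (rmem s a)" if "a \<noteq> 1" for a
        using u(4)[OF that] t(1) that
        by (simp add: Inv_def option.map_comp o_def add.assoc)
      moreover have "ops u \<le> ops s + Suc k * K" using u(5) t(1) by (simp add: Inv_def)
      ultimately show ?thesis using u by (auto simp: Inv_def registers_append x)
    qed
  qed
  then show "\<exists>t. exec ns xs (For x e c) s t \<and> J (rmem t) \<and> registers vs t \<and>
      (\<forall>a. a \<noteq> 1 \<longrightarrow> rmem t a = map_option (\<lambda>x. x + (\<Sum>k<N. g k a)) (rmem s a)) \<and>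
      ops t \<le> ops s + N * K"
    by (auto simp: Inv_def)
qed

lemma accumulates_Skip: "accumulates ns xs J vs Skip (\<lambda>_. 0) 0"
  unfolding accumulates_def using exec_Skip by (fastforce simp: option.map_ident)

lemma accumulates_Cond:
  assumes "\<And>s. J (rmem s) \<Longrightarrow> registers vs s \<Longrightarrow> bval ns s b \<longleftrightarrow> P"
    and "P \<Longrightarrow> accumulates ns xs J vs c g K"
    and "\<not> P \<Longrightarrow> accumulates ns xs J vs d h K'"
  shows "accumulates ns xs J vs (Cond b c d) (if P then g else h) (if P then K else K')"
  using assms unfolding accumulates_def
  by (cases P) (simp_all, (meson exec_CondTrue exec_CondFalse)+)

lemma accumulates_mono:
  "accumulates ns xs J vs c g K \<Longrightarrow> K \<le> K' \<Longrightarrow> accumulates ns xs J vs c g K'"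
  unfolding accumulates_def by (meson add_left_mono le_trans)

definition MulAdd :: "iexp \<Rightarrow> rarg \<Rightarrow> rarg \<Rightarrow> com" where
  "MulAdd a x y = Seq (RMul (IConst 1) x y) (RAdd a (RCell a) (RCell (IConst 1)))"

text \<open>The last premise admits every \<open>z\<close>: \<open>J\<close> may demand that the
  target cell is defined but must not fix its content, which \<open>accumulates\<close> alone
  tracks. The operands, in contrast, must be determined by \<open>J\<close> and the
  counters.\<close>

lemma accumulates_MulAdd:
  assumes a: "\<And>s. J (rmem s) \<Longrightarrow> registers vs s \<Longrightarrow> ival ns s a = c"
    and x: "\<And>s. J (rmem s) \<Longrightarrow> registers vs s \<Longrightarrow> rval ns xs s x = Some u"
    and y: "\<And>s. J (rmem s) \<Longrightarrow> registers vs s \<Longrightarrow> rval ns xs s y = Some v"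
    and c: "c \<noteq> 1" "\<And>m. J m \<Longrightarrow> m c \<noteq> None"
    and J: "\<And>m z. J m \<Longrightarrow> J (m(1 \<mapsto> u * v, c \<mapsto> z))"
  shows "accumulates ns xs J vs (MulAdd a x y) (\<lambda>b. if b = c then u * v else 0) 2"
  unfolding accumulates_def
proof (intro allI impI, elim conjE)
  fix s assume s: "J (rmem s)" "registers vs s"
  obtain z where z: "rmem s c = Some z" using c(2)[OF s(1)] by auto
  let ?s = "s\<lparr>rmem := (rmem s)(1 \<mapsto> u * v), ops := ops s + 1\<rparr>"
  let ?t = "?s\<lparr>rmem := (rmem ?s)(c \<mapsto> z + u * v), ops := ops ?s + 1\<rparr>"
  have "exec ns xs (RMul (IConst 1) x y) s ?s"
    using exec_RMul[OF x[OF s] y[OF s], of "IConst 1"] by simp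
  moreover have "exec ns xs (RAdd a (RCell a) (RCell (IConst 1))) ?s ?t"
    using exec_RAdd[of ns xs ?s "RCell a" z "RCell (IConst 1)" "u * v" a] z c(1) a[OF s] by simp
  ultimately have "exec ns xs (MulAdd a x y) s ?t"
    unfolding MulAdd_def by (rule exec_Seq)
  moreover have "J (rmem ?t)" using J[OF s(1)] by simp
  moreover have "registers vs ?t" using s(2) by (simp add: registers_def)
  moreover have "rmem ?t b = map_option (\<lambda>x. x + (if b = c then u * v else 0)) (rmem s b)"
    if "b \<noteq> 1" for b
    using that z by (simp add: option.map_ident)
  moreover have "ops ?t \<le> ops s + 2" by simp
  ultimately show "\<exists>t. exec ns xs (MulAdd a x y) s t \<and> J (rmem t) \<and> registers vs t \<and>
      (\<forall>b. b \<noteq> 1 \<longrightarrow> rmem t b = map_option (\<lambda>x. x + (if b = c then u * v else 0)) (rmem s b)) \<and>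
      ops t \<le> ops s + 2" by blast
qed


section \<open>Weights of derivation trees\<close>

definition word_mat :: "'a hmm \<Rightarrow> 'a list \<Rightarrow> real mat" where
  "word_mat A w = foldr (\<lambda>a M. trans A a * M) w (1\<^sub>m (states A))"

text \<open>Yields are never empty, so the index \<open>l\<close> stands for length
  \<open>l + 1\<close> and the layers of the table start at 0.\<close>

definition trees :: "'a cfg \<Rightarrow> nat \<Rightarrow> nat \<Rightarrow> 'a tree set" where
  "trees G l i = {t. derivation_tree G t \<and> tree_root t = i \<and> length (tree_yield t) = Suc l}"

definition tree_weight :: "'a hmm \<Rightarrow> 'a cfg \<Rightarrow> nat \<Rightarrow> nat \<Rightarrow> nat \<Rightarrow> nat \<Rightarrow> real" where
  "tree_weight A G l i p q = (\<Sum>t \<in> trees G l i. word_mat A (tree_yield t) $$ (p, q))"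

lemma hmm_trans_carrier: "hmm \<Sigma> A \<Longrightarrow> a \<in> \<Sigma> \<Longrightarrow> trans A a \<in> carrier_mat (states A) (states A)"
  by (simp add: hmm_def)

lemma word_mat_carrier:
  "hmm \<Sigma> A \<Longrightarrow> set w \<subseteq> \<Sigma> \<Longrightarrow> word_mat A w \<in> carrier_mat (states A) (states A)"
  by (induction w) (auto simp: word_mat_def intro!: mult_carrier_mat hmm_trans_carrier)

lemma word_mat_append:
  assumes "hmm \<Sigma> A" "set u \<subseteq> \<Sigma>" "set v \<subseteq> \<Sigma>"
  shows "word_mat A (u @ v) = word_mat A u * word_mat A v"
  using assms(2)
proof (induction u)
  case Nil
  show ?case using word_mat_carrier[OF assms(1,3)] by (simp add: word_mat_def)
next
  case (Cons a u)
  have "word_mat A (a # u @ v) = trans A a * (word_mat A u * word_mat A v)"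
    using Cons by (simp add: word_mat_def)
  also have "\<dots> = (trans A a * word_mat A u) * word_mat A v"
    using Cons.prems assms
    by (intro assoc_mult_mat[symmetric, of _ "states A" "states A" _ "states A" _ "states A"] hmm_trans_carrier[where \<Sigma> = \<Sigma>]
        word_mat_carrier[where \<Sigma> = \<Sigma>]) auto
  finally show ?case by (simp add: word_mat_def)
qed

lemma tree_yield_alphabet:
  "chomsky_cfg \<Sigma> G \<Longrightarrow> derivation_tree G t \<Longrightarrow> set (tree_yield t) \<subseteq> \<Sigma>"
  by (induction t) (auto simp: chomsky_cfg_def)

lemma finite_trees: "finite (rules G) \<Longrightarrow> finite (trees G l i)"
  by (rule finite_subset[OF _ finite_derivation_trees_upto[of G "Suc l"]]) (auto simp: trees_def)

text \<open>The trees whose root applies the given rule. With indices one less than lengths, the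
  indices \<open>d\<close> and \<open>l - 1 - d\<close> of the subtrees mean
  \<open>(d + 1) + (l - d) = l + 1\<close> letters.\<close>

fun rule_trees :: "'a cfg \<Rightarrow> nat \<Rightarrow> nat \<Rightarrow> 'a rule \<Rightarrow> 'a tree set" where
  "rule_trees G l i (Binary i' j k) = (if i' = i then
     \<Union>d<l. (\<lambda>(t, u). Node i t u) ` (trees G d j \<times> trees G (l - 1 - d) k) else {})"
| "rule_trees G l i (Terminal i' a) = (if i' = i \<and> l = 0 then {Leaf i a} else {})"

lemma trees_eq: "trees G l i = (\<Union>r \<in> rules G. rule_trees G l i r)"
proof (intro equalityI subsetI)
  fix t assume t: "t \<in> trees G l i"
  show "t \<in> (\<Union>r \<in> rules G. rule_trees G l i r)"
  proof (cases t)
    case (Leaf i' a)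
    then show ?thesis using t by (force simp: trees_def)
  next
    case (Node i' u v)
    obtain x where x: "length (tree_yield u) = Suc x"
      using tree_yield_nonempty[of u] by (cases "tree_yield u") auto
    obtain y where y: "length (tree_yield v) = Suc y"
      using tree_yield_nonempty[of v] by (cases "tree_yield v") auto
    have "l = Suc (x + y)" using t Node x y by (simp add: trees_def)
    then have "t \<in> rule_trees G l i (Binary i (tree_root u) (tree_root v))"
      using t Node x y by (auto simp: trees_def intro!: bexI[of _ x])
    moreover have "Binary i (tree_root u) (tree_root v) \<in> rules G"
      using t Node by (auto simp: trees_def)
    ultimately show ?thesis by blast
  qed
next
  fix t assume "t \<in> (\<Union>r \<in> rules G. rule_trees G l i r)"
  then obtain r where "r \<in> rules G" "t \<in> rule_trees G l i r" by blast
  then show "t \<in> trees G l i"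
    by (cases r) (auto simp: trees_def split: if_splits)
qed

lemma rule_trees_disjoint: "r \<noteq> r' \<Longrightarrow> rule_trees G l i r \<inter> rule_trees G l i r' = {}"
  by (cases r; cases r') (auto simp: trees_def)

text \<open>Distributivity: a sum over pairs of subtrees becomes a product of two table entries, so
  the cost does not depend on the number of trees.\<close>

lemma sum_product_swap:
  fixes f :: "'b \<Rightarrow> 'd \<Rightarrow> real"
  shows "(\<Sum>(x, y) \<in> X \<times> Y. \<Sum>s \<in> S. f x s * g y s) =
    (\<Sum>s \<in> S. (\<Sum>x \<in> X. f x s) * (\<Sum>y \<in> Y. g y s))"
proof -
  have "(\<Sum>(x, y) \<in> X \<times> Y. \<Sum>s \<in> S. f x s * g y s) = (\<Sum>x \<in> X. \<Sum>s \<in> S. \<Sum>y \<in> Y. f x s * g y s)"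
    by (simp add: sum.cartesian_product[symmetric] sum.swap[of _ S Y])
  also have "\<dots> = (\<Sum>s \<in> S. \<Sum>x \<in> X. \<Sum>y \<in> Y. f x s * g y s)" by (rule sum.swap)
  finally show ?thesis by (simp add: sum_product)
qed

text \<open>The sum ranges over all rules, with a guard on the left-hand side, because the program
  also scans all rules in each layer; the two can then be compared rule by rule.\<close>

lemma tree_weight_rec:
  assumes "chomsky_cfg \<Sigma> G" "hmm \<Sigma> A" "p < states A" "q < states A"
  shows "tree_weight A G l i p q = (\<Sum>r \<in> rules G. case r of
      Binary i' j k \<Rightarrow> if i' = i then \<Sum>d<l. \<Sum>s<states A.
        tree_weight A G d j p s * tree_weight A G (l - 1 - d) k s q else 0
    | Terminal i' a \<Rightarrow> if i' = i \<and> l = 0 then trans A a $$ (p, q) else 0)"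
proof -
  let ?w = "\<lambda>t. word_mat A (tree_yield t)"
  have fin: "finite (rules G)" using assms(1) by (simp add: chomsky_cfg_def)
  note ft = finite_trees[OF fin]
  have carrier: "?w t \<in> carrier_mat (states A) (states A)" if "t \<in> trees G l i" for t l i
    using that tree_yield_alphabet[OF assms(1)] by (intro word_mat_carrier[OF assms(2)]) (simp add: trees_def)
  have node: "?w (Node i t u) $$ (p, q) = (\<Sum>s<states A. ?w t $$ (p, s) * ?w u $$ (s, q))"
    if "t \<in> trees G d j" "u \<in> trees G d' k" for t u d j d' k
  proof -
    have "?w (Node i t u) = ?w t * ?w u"
      using that tree_yield_alphabet[OF assms(1)]
      by (simp add: trees_def word_mat_append[OF assms(2)])
    then show ?thesis
      using carrier[OF that(1)] carrier[OF that(2)] assms(3,4)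
      by (simp add: scalar_prod_def lessThan_atLeast0)
  qed
  have binary: "(\<Sum>t \<in> rule_trees G l i (Binary i j k). ?w t $$ (p, q)) =
      (\<Sum>d<l. \<Sum>s<states A. tree_weight A G d j p s * tree_weight A G (l - 1 - d) k s q)" for j k
  proof -
    let ?S = "\<lambda>d. trees G d j \<times> trees G (l - 1 - d) k"
    have "(\<Sum>t \<in> rule_trees G l i (Binary i j k). ?w t $$ (p, q)) =
        (\<Sum>d<l. \<Sum>t \<in> (\<lambda>(t, u). Node i t u) ` ?S d. ?w t $$ (p, q))"
      unfolding rule_trees.simps if_P[OF refl]
      \<comment> \<open>Different splits give disjoint sets, since the yield length of the left
        subtree determines \<open>d\<close>.\<close>
      by (rule sum.UNION_disjoint) (use ft in \<open>auto simp: trees_def\<close>)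
    also have "\<dots> = (\<Sum>d<l. \<Sum>(t, u) \<in> ?S d. ?w (Node i t u) $$ (p, q))"
      by (intro sum.cong refl, subst sum.reindex) (auto simp: inj_on_def o_def case_prod_unfold)
    also have "\<dots> = (\<Sum>d<l. \<Sum>(t, u) \<in> ?S d. \<Sum>s<states A. ?w t $$ (p, s) * ?w u $$ (s, q))"
      by (intro sum.cong refl) (use node in auto)
    also have "\<dots> = (\<Sum>d<l. \<Sum>s<states A. tree_weight A G d j p s * tree_weight A G (l - 1 - d) k s q)"
      unfolding tree_weight_def by (intro sum.cong refl sum_product_swap)
    finally show ?thesis .
  qed
  have "tree_weight A G l i p q = (\<Sum>r \<in> rules G. \<Sum>t \<in> rule_trees G l i r. ?w t $$ (p, q))"
    unfolding tree_weight_def trees_eq[of G l i]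
  proof (rule sum.UNION_disjoint[OF fin])
    show "\<forall>r \<in> rules G. finite (rule_trees G l i r)"
      using finite_subset[OF _ ft[of l i]] trees_eq[of G l i] by blast
  qed (use rule_trees_disjoint in blast)
  also have "\<dots> = (\<Sum>r \<in> rules G. case r of
      Binary i' j k \<Rightarrow> if i' = i then \<Sum>d<l. \<Sum>s<states A.
        tree_weight A G d j p s * tree_weight A G (l - 1 - d) k s q else 0
    | Terminal i' a \<Rightarrow> if i' = i \<and> l = 0 then trans A a $$ (p, q) else 0)"
  proof (intro sum.cong refl)
    fix r assume r: "r \<in> rules G"
    show "(\<Sum>t \<in> rule_trees G l i r. ?w t $$ (p, q)) = (case r of
        Binary i' j k \<Rightarrow> if i' = i then \<Sum>d<l. \<Sum>s<states A.
          tree_weight A G d j p s * tree_weight A G (l - 1 - d) k s q else 0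
      | Terminal i' a \<Rightarrow> if i' = i \<and> l = 0 then trans A a $$ (p, q) else 0)"
    proof (cases r)
      case (Binary i' j k)
      then show ?thesis using binary by (cases "i' = i") (simp_all del: rule_trees.simps, simp)
    next
      case (Terminal i' a)
      then have "trans A a \<in> carrier_mat (states A) (states A)"
        using r assms(1) by (intro hmm_trans_carrier[OF assms(2)]) (auto simp: chomsky_cfg_def)
      then show ?thesis using Terminal by (simp add: word_mat_def)
    qed
  qed
  finally show ?thesis .
qed

lemma hmm_prob_word_mat:
  assumes "hmm \<Sigma> A" "set w \<subseteq> \<Sigma>"
  shows "hmm_prob A w =
    (\<Sum>p<states A. \<Sum>q<states A. init_dist A $ p * word_mat A w $$ (p, q))"
proof -
  have "init_dist A \<in> carrier_vec (states A)" using assms(1) by (simp add: hmm_def)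
  then show ?thesis
    using word_mat_carrier[OF assms]
    unfolding hmm_prob_def word_mat_def[symmetric]
    by (simp add: scalar_prod_def lessThan_atLeast0 sum_distrib_left)
qed

text \<open>Unambiguity makes the yield a bijection from the trees rooted in the start symbol to the words.\<close>

lemma hmm_prob_set_lang:
  assumes G: "chomsky_cfg \<Sigma> G" "unambiguous G" and A: "hmm \<Sigma> A"
  shows "hmm_prob_set A (lang G \<inter> words \<Sigma> (Suc l)) =
    (\<Sum>p<states A. \<Sum>q<states A. init_dist A $ p * tree_weight A G l (start G) p q)"
proof -
  let ?T = "trees G l (start G)"
  let ?D = "\<lambda>w. {t. derivation_tree G t \<and> tree_root t = start G \<and> tree_yield t = w}"
  \<comment> \<open>Finiteness matters twice: an infinite set has cardinality 0, so otherwise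
    \<open>card \<le> 1\<close> would not give uniqueness, nor non-emptiness give
    \<open>card \<ge> 1\<close>.\<close>
  have fin: "finite (?D w)" for w
    using finite_derivations G(1) by (auto simp: chomsky_cfg_def)
  have "inj_on tree_yield ?T"
  proof (rule inj_onI)
    fix t u assume "t \<in> ?T" "u \<in> ?T" "tree_yield t = tree_yield u"
    then have "t \<in> ?D (tree_yield u)" "u \<in> ?D (tree_yield u)" by (auto simp: trees_def)
    moreover have "card (?D (tree_yield u)) \<le> 1"
      using G(2) by (simp add: unambiguous_def num_derivations_def)
    ultimately show "t = u" using fin card_le_Suc0_iff_eq[of "?D (tree_yield u)"] by auto
  qed
  moreover have "tree_yield ` ?T = lang G \<inter> words \<Sigma> (Suc l)"
  proof -
    have "w \<in> lang G \<longleftrightarrow> ?D w \<noteq> {}" for w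
      using fin[of w] by (simp add: lang_def num_derivations_def Suc_le_eq card_gt_0_iff)
    then show ?thesis
      using tree_yield_alphabet[OF G(1)] by (auto simp: trees_def words_def image_iff)
  qed
  ultimately have "hmm_prob_set A (lang G \<inter> words \<Sigma> (Suc l)) = (\<Sum>t \<in> ?T. hmm_prob A (tree_yield t))"
    unfolding hmm_prob_set_def by (metis (no_types, lifting) sum.reindex_cong)
  also have "\<dots> = (\<Sum>t \<in> ?T. \<Sum>p<states A. \<Sum>q<states A.
      init_dist A $ p * word_mat A (tree_yield t) $$ (p, q))"
    using tree_yield_alphabet[OF G(1)]
    by (intro sum.cong refl hmm_prob_word_mat[OF A]) (simp add: trees_def)
  also have "\<dots> = (\<Sum>p<states A. \<Sum>q<states A. init_dist A $ p * tree_weight A G l (start G) p q)"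
    unfolding tree_weight_def sum_distrib_left
    by (subst sum.swap, intro sum.cong refl, subst sum.swap) simp
  finally show ?thesis .
qed


section \<open>The dynamic program\<close>

lemma length_concat_uniform:
  "(\<And>x. x \<in> set xs \<Longrightarrow> length (f x) = m) \<Longrightarrow> length (concat (map f xs)) = length xs * m"
  by (induction xs) auto

lemma nth_concat_uniform:
  assumes "\<And>x. x \<in> set xs \<Longrightarrow> length (f x) = m" "i < length xs" "j < m"
  shows "concat (map f xs) ! (i * m + j) = f (xs ! i) ! j"
  using assms
proof (induction xs arbitrary: i)
  case (Cons x xs)
  then show ?case by (cases i) (auto simp: nth_append add.assoc)
qed simp

lemma mixed_radix_less: "x < a \<Longrightarrow> y < b \<Longrightarrow> x * b + y < a * (b :: nat)"
  by (metis add.commute add_strict_left_mono le_trans less_le_trans mult_Suc mult_le_mono1 Suc_leI)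

lemma mixed_radix_inj:
  assumes "y < b" "y' < b"
  shows "x * b + y = x' * b + y' \<longleftrightarrow> x = x' \<and> y = (y' :: nat)"
proof
  assume eq: "x * b + y = x' * b + y'"
  have "(x * b + y) div b = x" "(x' * b + y') div b = x'" using assms by simp_all
  then show "x = x' \<and> y = y'" using eq by simp
qed simp

lemma letter_index: "a \<in> set xs \<Longrightarrow> letter_index xs a < length xs \<and> xs ! letter_index xs a = a"
  unfolding letter_index_def
  by (induction xs) auto

text \<open>
  The table entry for derivations from nonterminal \<open>i + 1\<close> of words of length \<open>l + 1\<close> that take
  state \<open>p\<close> to state \<open>q\<close>. Cell 0 holds the result and cell 1 is the scratch cell.
\<close>

definition table_addr :: "nat \<Rightarrow> nat \<Rightarrow> nat \<Rightarrow> nat \<Rightarrow> nat \<Rightarrow> nat \<Rightarrow> nat" where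
  "table_addr n m l i p q = 2 + (((l * n + i) * m + p) * m + q)"

lemma table_addr_less:
  "l < L \<Longrightarrow> i < n \<Longrightarrow> p < m \<Longrightarrow> q < m \<Longrightarrow> table_addr n m l i p q < 2 + L * n * m * m"
  unfolding table_addr_def by (intro add_strict_left_mono mixed_radix_less)

text \<open>Uniqueness of mixed-radix digits; the layer is the most significant digit and may be
  arbitrarily large.\<close>

lemma table_addr_inj:
  assumes "i < n" "i' < n" "p < m" "p' < m" "q < m" "q' < m"
  shows "table_addr n m l i p q = table_addr n m l' i' p' q' \<longleftrightarrow>
    l = l' \<and> i = i' \<and> p = p' \<and> q = q'"
  using assms by (auto simp: table_addr_def mixed_radix_inj)

section \<open>The text of the program\<close>

abbreviation "num_nonterms \<equiv> IInput (IConst 0)"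
abbreviation "start_symbol \<equiv> IInput (IConst 1)"
abbreviation "num_rules \<equiv> IInput (IConst 3)"
abbreviation "num_states \<equiv> IInput (IConst 4)"
abbreviation "word_length \<equiv> IInput (IConst 5)"

abbreviation reg :: "nat \<Rightarrow> iexp" where "reg x \<equiv> ICell (IConst x)"

text \<open>The header of the input has 6 numbers and each rule takes 4; register 1 is the counter
  of the loop over the rules.\<close>

definition rule_field :: "nat \<Rightarrow> iexp" where
  "rule_field c = IInput (IAdd (IConst 6) (IAdd (IMul (reg 1) (IConst 4)) (IConst c)))"

text \<open>Nonterminals are numbered from 1 but digits from 0, hence the subtraction.\<close>

definition table_exp :: "iexp \<Rightarrow> iexp \<Rightarrow> iexp \<Rightarrow> iexp \<Rightarrow> iexp" where
  "table_exp l i p q = IAdd (IConst 2) (IAdd (IMul (IAdd (IMul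
     (IAdd (IMul l num_nonterms) (ISub i (IConst 1))) num_states) p) num_states) q)"

definition init_prog :: com where
  "init_prog = For 0 (IAdd (IConst 2)
     (IMul (IMul (IMul word_length num_nonterms) num_states) num_states)) (RSet (reg 0) RZero)"

text \<open>Registers: 0 layer, 1 rule, 2 split, 3 and 4 the outer states \<open>p\<close> and
  \<open>q\<close>, 5 the intermediate state.\<close>

definition binary_prog :: com where
  "binary_prog = For 2 (reg 0) (For 3 num_states (For 4 num_states (For 5 num_states
     (MulAdd (table_exp (reg 0) (rule_field 1) (reg 3) (reg 4))
       (RCell (table_exp (reg 2) (rule_field 2) (reg 3) (reg 5)))
       (RCell (table_exp (ISub (ISub (reg 0) (IConst 1)) (reg 2)) (rule_field 3) (reg 5) (reg 4)))))))"

text \<open>Only layer 0 contains single letters. Multiplying by \<open>ROne\<close> gives this step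
  the common accumulation shape, and several rules may add to the same cell.\<close>

definition terminal_prog :: com where
  "terminal_prog = Cond (Less (reg 0) (IConst 1))
     (For 2 num_states (For 3 num_states
       (MulAdd (table_exp (reg 0) (rule_field 1) (reg 2) (reg 3)) ROne
         (RInput (IAdd num_states (IAdd (IMul (IAdd (IMul (rule_field 2) num_states) (reg 2))
            num_states) (reg 3))))))) Skip"

definition layer_prog :: com where
  "layer_prog = For 1 num_rules (Cond (Less (rule_field 0) (IConst 1)) binary_prog terminal_prog)"

definition output_prog :: com where
  "output_prog = For 0 num_states (For 1 num_states (MulAdd (IConst 0) (RInput (reg 0))
     (RCell (table_exp (ISub word_length (IConst 1)) start_symbol (reg 0) (reg 1)))))"

text \<open>Without rules no operation is allowed, hence the conditional.\<close>

definition inside_prog :: com where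
  "inside_prog = Seq init_prog (Cond (Less (IConst 0) num_rules)
     (Seq (For 0 word_length layer_prog) output_prog) Skip)"

section \<open>Correctness and cost on a fixed input\<close>

locale inside_setting =
  fixes \<Sigma> :: "'a set" and G :: "'a cfg" and A :: "'a hmm" and L :: nat
    and al :: "'a list" and rs :: "'a rule list"
  assumes chomsky: "chomsky_cfg \<Sigma> G" and unamb: "unambiguous G" and hmm: "hmm \<Sigma> A"
    and L_pos: "L > 0" and al: "set al = \<Sigma>"
    and rs: "distinct rs" "set rs = rules G"
begin

abbreviation "n \<equiv> nonterms G"
abbreviation "m \<equiv> states A"
abbreviation "ns \<equiv> nat_input al G rs A L"
abbreviation "xs \<equiv> real_input al A"
abbreviation "addr \<equiv> table_addr n m"
abbreviation "M \<equiv> 2 + L * n * m * m"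
abbreviation "T \<equiv> tree_weight A G"

lemma start_bounds: "start G \<ge> 1" "start G \<le> n"
  using chomsky by (auto simp: chomsky_cfg_def)

lemma states_pos: "m > 0"
  using hmm by (cases "m = 0") (auto simp: hmm_def)

lemma input_simps [simp]:
  "ival ns s num_nonterms = n" "ival ns s (IInput (IConst (Suc 0))) = start G"
  "ival ns s num_rules = length rs" "ival ns s num_states = m" "ival ns s word_length = L"
  by (simp_all add: nat_input_def)

lemma ival_rule_field:
  assumes "imem s 1 < length rs" "c < 4"
  shows "ival ns s (rule_field c) = encode_rule al (rs ! imem s 1) ! c"
proof -
  have len: "length (encode_rule al r) = 4" for r :: "'a rule" by (cases r) auto
  have "imem s 1 * 4 + c < length (concat (map (encode_rule al) rs))"
    using length_concat_uniform[of rs "encode_rule al" 4] len assms by simp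
  then show ?thesis
    using nth_concat_uniform[of rs "encode_rule al" 4 "imem s 1" c] len assms
    by (simp add: rule_field_def nat_input_def Let_def nth_append del: ival.simps(2))
       (simp add: nth_append)
qed

lemma ival_table_exp:
  "ival ns s (table_exp l i p q) =
    addr (ival ns s l) (ival ns s i - 1) (ival ns s p) (ival ns s q)"
  unfolding table_exp_def table_addr_def by (simp del: ival.simps(3))

lemma real_input_init: "p < m \<Longrightarrow> p < length xs \<and> xs ! p = init_dist A $ p"
  by (simp add: real_input_def nth_append)

lemma real_input_trans:
  assumes "a < length al" "p < m" "q < m"
  defines "k \<equiv> m + ((a * m + p) * m + q)"
  shows "k < length xs \<and> xs ! k = trans A (al ! a) $$ (p, q)"
proof -
  let ?row = "\<lambda>a p. map (\<lambda>q. trans A a $$ (p, q)) [0..<m]"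
  let ?mat = "\<lambda>a. concat (map (?row a) [0..<m])"
  have mat: "length (?mat a) = m * m" for a
    using length_concat_uniform[of "[0..<m]" "?row a" m] by simp
  \<comment> \<open>The Horner form of the address is regrouped to match the blocks of the input:
    matrix, row, entry.\<close>
  have k: "k = m + (a * (m * m) + (p * m + q))" unfolding k_def by (simp add: algebra_simps)
  have pq: "p * m + q < m * m" using assms by (intro mixed_radix_less)
  have "?mat (al ! a) ! (p * m + q) = trans A (al ! a) $$ (p, q)"
    using nth_concat_uniform[of "[0..<m]" "?row (al ! a)" m p q] assms by simp
  moreover have "concat (map ?mat al) ! (a * (m * m) + (p * m + q)) = ?mat (al ! a) ! (p * m + q)"
    using nth_concat_uniform[of al ?mat "m * m" a "p * m + q"] assms pq mat by simp
  moreover have "length (concat (map ?mat al)) = length al * (m * m)"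
    using length_concat_uniform[of al ?mat "m * m"] mat by simp
  moreover have "a * (m * m) + (p * m + q) < length al * (m * m)"
    using assms pq by (intro mixed_radix_less)
  ultimately show ?thesis unfolding real_input_def k by (simp add: nth_append)
qed

text \<open>Layers from \<open>l\<close> on and cells 0 and 1 must be defined but may hold anything,
  which lets the property survive all writes while layer \<open>l\<close> is being filled. The exact
  domain later yields the number of cells.\<close>

definition filled :: "nat \<Rightarrow> (nat \<rightharpoonup> real) \<Rightarrow> bool" where
  "filled l f \<longleftrightarrow> dom f = {..<M} \<and>
     (\<forall>d<l. \<forall>j\<in>{1..n}. \<forall>p<m. \<forall>q<m. f (addr d (j - 1) p q) = Some (T d j p q))"

lemma filled_upd:
  assumes "filled l f" "l \<le> l'" "l' < L" "i \<in> {1..n}" "p < m" "q < m"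
  shows "filled l (f(1 \<mapsto> u, addr l' (i - 1) p q \<mapsto> z))"
proof -
  have *: "x - 1 < n" if "x \<in> {1..n}" for x using that by auto
  have "addr l' (i - 1) p q < M" using assms * by (intro table_addr_less) auto
  moreover have "addr d (j - 1) p' q' \<noteq> 1" for d j p' q' by (simp add: table_addr_def)
  ultimately show ?thesis
    using assms * unfolding filled_def by (auto simp: table_addr_inj)
qed

lemma filled_dom: "filled l f \<Longrightarrow> l' < L \<Longrightarrow> i \<in> {1..n} \<Longrightarrow> p < m \<Longrightarrow> q < m \<Longrightarrow>
   f (addr l' (i - 1) p q) \<noteq> None"
  using table_addr_less[of l' L "i - 1" n p m q] by (auto simp: filled_def dom_def set_eq_iff)

text \<open>Mirrors the loop nest literally, one indicator of the target cell per innermost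
  iteration; the sums are collapsed later.\<close>

fun rule_contrib :: "nat \<Rightarrow> 'a rule \<Rightarrow> nat \<Rightarrow> real" where
  "rule_contrib l (Binary i j k) b = (\<Sum>d<l. \<Sum>p<m. \<Sum>q<m. \<Sum>s<m.
     if b = addr l (i - 1) p q then T d j p s * T (l - 1 - d) k s q else 0)"
| "rule_contrib l (Terminal i a) b = (if l < 1 then \<Sum>p<m. \<Sum>q<m.
     if b = addr l (i - 1) p q then 1 * trans A a $$ (p, q) else 0 else 0)"

lemma rule_bounds:
  assumes "r < length rs"
  shows "rs ! r = Binary i j k \<Longrightarrow> {i, j, k} \<subseteq> {1..n}"
    and "rs ! r = Terminal i a \<Longrightarrow> i \<in> {1..n} \<and> a \<in> \<Sigma>"
proof -
  have "rs ! r \<in> rules G" using assms rs(2) nth_mem by blast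
  then show "rs ! r = Binary i j k \<Longrightarrow> {i, j, k} \<subseteq> {1..n}"
    and "rs ! r = Terminal i a \<Longrightarrow> i \<in> {1..n} \<and> a \<in> \<Sigma>"
    using chomsky unfolding chomsky_cfg_def by fastforce+
qed

lemma registers_simps:
  "registers [] s"
  "registers [a] s \<longleftrightarrow> imem s 0 = a"
  "registers [a, b] s \<longleftrightarrow> imem s 0 = a \<and> imem s 1 = b"
  "registers [a, b, c] s \<longleftrightarrow> imem s 0 = a \<and> imem s 1 = b \<and> imem s 2 = c"
  "registers [a, b, c, d] s \<longleftrightarrow> imem s 0 = a \<and> imem s 1 = b \<and> imem s 2 = c \<and> imem s 3 = d"
  "registers [a, b, c, d, e] s \<longleftrightarrow>
     imem s 0 = a \<and> imem s 1 = b \<and> imem s 2 = c \<and> imem s 3 = d \<and> imem s 4 = e"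
  "registers [a, b, c, d, e, f] s \<longleftrightarrow>
     imem s 0 = a \<and> imem s 1 = b \<and> imem s 2 = c \<and> imem s 3 = d \<and> imem s 4 = e \<and> imem s 5 = f"
  by (auto simp: registers_def numeral_eq_Suc)

text \<open>The operands lie in layers \<open>d\<close> and \<open>l - 1 - d\<close>, both below
  \<open>l\<close>, so \<open>filled l\<close> fixes their values, whereas all writes to the table
  go to layer \<open>l\<close>.\<close>

lemma binary_prog:
  assumes l: "l < L" and r: "r < length rs" "rs ! r = Binary i j k"
  shows "accumulates ns xs (filled l) [l, r] binary_prog (rule_contrib l (Binary i j k))
    (l * (m * (m * (m * 2))))"
  unfolding binary_prog_def rule_contrib.simps
proof (rule accumulates_For)
  note ijk = rule_bounds(1)[OF r]
  fix d assume d: "d < l"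
  show "accumulates ns xs (filled l) ([l, r] @ [d])
     (For 3 num_states (For 4 num_states (For 5 num_states
     (MulAdd (table_exp (reg 0) (rule_field 1) (reg 3) (reg 4))
       (RCell (table_exp (reg 2) (rule_field 2) (reg 3) (reg 5)))
       (RCell (table_exp (ISub (ISub (reg 0) (IConst 1)) (reg 2)) (rule_field 3) (reg 5) (reg 4)))))))
     (\<lambda>b. \<Sum>p<m. \<Sum>q<m. \<Sum>s<m.
       if b = addr l (i - 1) p q then T d j p s * T (l - 1 - d) k s q else 0)
     (m * (m * (m * 2)))"
  proof (intro accumulates_For)
    fix p q s assume "p < m" "q < m" "s < m"
    then show "accumulates ns xs (filled l) (((([l, r] @ [d]) @ [p]) @ [q]) @ [s])
     (MulAdd (table_exp (reg 0) (rule_field 1) (reg 3) (reg 4))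
       (RCell (table_exp (reg 2) (rule_field 2) (reg 3) (reg 5)))
       (RCell (table_exp (ISub (ISub (reg 0) (IConst 1)) (reg 2)) (rule_field 3) (reg 5) (reg 4))))
     (\<lambda>b. if b = addr l (i - 1) p q then T d j p s * T (l - 1 - d) k s q else 0) 2"
      using l r ijk d
      by (intro accumulates_MulAdd filled_upd filled_dom)
        (auto simp: registers_simps ival_table_exp ival_rule_field filled_def table_addr_def[of _ _ _ _ _ "_ :: nat"])
  qed (simp_all del: ival.simps(3))
qed (auto simp: registers_simps)

lemma terminal_prog:
  assumes l: "l < L" and r: "r < length rs" "rs ! r = Terminal i a"
  shows "accumulates ns xs (filled l) [l, r] terminal_prog (rule_contrib l (Terminal i a))
    (if l < 1 then m * (m * 2) else 0)"
proof -
  note ia = rule_bounds(2)[OF r]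
  then have a: "letter_index al a < length al" "al ! letter_index al a = a"
    using letter_index[of a al] al by auto
  have "accumulates ns xs (filled l) [l, r] terminal_prog
      (if l < 1 then (\<lambda>b. \<Sum>p<m. \<Sum>q<m. if b = addr l (i - 1) p q then 1 * trans A a $$ (p, q) else 0)
       else (\<lambda>_. 0))
      (if l < 1 then m * (m * 2) else 0)"
    unfolding terminal_prog_def
  proof (intro accumulates_Cond accumulates_For accumulates_Skip)
    fix p q assume pq: "p < m" "q < m"
    let ?k = "m + ((letter_index al a * m + p) * m + q)"
    have k: "?k < length xs" "xs ! ?k = trans A a $$ (p, q)"
      using real_input_trans[OF a(1) pq] a(2) by simp_all
    show "accumulates ns xs (filled l) (([l, r] @ [p]) @ [q])
       (MulAdd (table_exp (reg 0) (rule_field 1) (reg 2) (reg 3)) ROne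
         (RInput (IAdd num_states (IAdd (IMul (IAdd (IMul (rule_field 2) num_states) (reg 2))
            num_states) (reg 3)))))
       (\<lambda>b. if b = addr l (i - 1) p q then 1 * trans A a $$ (p, q) else 0) 2"
    proof (intro accumulates_MulAdd filled_upd filled_dom)
      fix s assume "registers (([l, r] @ [p]) @ [q]) s"
      then show "rval ns xs s (RInput (IAdd num_states (IAdd (IMul (IAdd (IMul (rule_field 2) num_states)
         (reg 2)) num_states) (reg 3)))) = Some (trans A a $$ (p, q))"
        using k r by (simp add: registers_simps ival_rule_field del: ival.simps(3))
    qed (use l r ia pq in \<open>auto simp: registers_simps ival_table_exp ival_rule_field
        table_addr_def[of _ _ _ _ _ "_ :: nat"]\<close>)
  qed (auto simp: registers_simps simp del: ival.simps(3))
  moreover have "(if l < 1 then (\<lambda>b. \<Sum>p<m. \<Sum>q<m. if b = addr l (i - 1) p q then 1 * trans A a $$ (p, q) else 0)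
       else (\<lambda>_. 0)) = rule_contrib l (Terminal i a)" by auto
  ultimately show ?thesis by simp
qed

lemma layer_prog:
  assumes l: "l < L"
  shows "accumulates ns xs (filled l) [l] layer_prog
    (\<lambda>b. \<Sum>r<length rs. rule_contrib l (rs ! r) b) (length rs * (2 * L * m ^ 3))"
  unfolding layer_prog_def
proof (rule accumulates_For)
  fix r assume r: "r < length rs"
  show "accumulates ns xs (filled l) ([l] @ [r])
     (Cond (Less (rule_field 0) (IConst 1)) binary_prog terminal_prog)
     (rule_contrib l (rs ! r)) (2 * L * m ^ 3)"
  proof (cases "rs ! r")
    case (Binary i j k)
    have "l * (m * (m * (m * 2))) \<le> 2 * L * m ^ 3"
      using l by (simp add: power3_eq_cube)
    then have "accumulates ns xs (filled l) [l, r] binary_prog (rule_contrib l (Binary i j k))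
        (2 * L * m ^ 3)"
      using binary_prog[OF l r Binary] accumulates_mono by blast
    \<comment> \<open>The kind of the rule is known here, so the condition is a constant and
      \<open>undefined\<close> stands for the branch never taken.\<close>
    then have "accumulates ns xs (filled l) [l, r]
        (Cond (Less (rule_field 0) (IConst 1)) binary_prog terminal_prog)
        (if True then rule_contrib l (rs ! r) else undefined)
        (if True then 2 * L * m ^ 3 else undefined)"
      using r Binary by (intro accumulates_Cond) (auto simp: registers_simps ival_rule_field)
    then show ?thesis by simp
  next
    case (Terminal i a)
    have "m * (m * 2) \<le> 2 * L * m ^ 3"
      using L_pos states_pos by (simp add: power3_eq_cube Suc_le_eq)
    then have "(if l < 1 then m * (m * 2) else 0) \<le> 2 * L * m ^ 3" by simp
    then have "accumulates ns xs (filled l) [l, r] terminal_prog (rule_contrib l (Terminal i a))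
        (2 * L * m ^ 3)"
      using terminal_prog[OF l r Terminal] accumulates_mono by blast
    then have "accumulates ns xs (filled l) [l, r]
        (Cond (Less (rule_field 0) (IConst 1)) binary_prog terminal_prog)
        (if False then undefined else rule_contrib l (rs ! r))
        (if False then undefined else 2 * L * m ^ 3)"
      using r Terminal by (intro accumulates_Cond) (auto simp: registers_simps ival_rule_field)
    then show ?thesis by simp
  qed
qed (simp_all del: ival.simps(3))

section \<open>From loop sums to the recurrence for tree weights\<close>

lemma sum_table_addr:
  assumes "i < n" "i' < n" "p < m" "q < m"
  shows "(\<Sum>p'<m. \<Sum>q'<m. if addr l i p q = addr l' i' p' q' then f p' q' else (0 :: real)) =
    (if l = l' \<and> i = i' then f p q else 0)"
proof -
  have "(\<Sum>q'<m. if addr l i p q = addr l' i' p' q' then f p' q' else 0) =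
      (if p = p' then (if l = l' \<and> i = i' then f p q else 0) else 0)" if "p' < m" for p'
  proof -
    have "(\<Sum>q'<m. if addr l i p q = addr l' i' p' q' then f p' q' else 0) =
        (\<Sum>q'<m. if q = q' then (if p = p' \<and> l = l' \<and> i = i' then f p' q' else 0) else 0)"
      using assms that by (intro sum.cong refl) (auto simp: table_addr_inj)
    then show ?thesis using assms by (simp add: sum.delta')
  qed
  then show ?thesis using assms by (simp add: sum.delta')
qed

lemma rule_contrib_table:
  assumes r: "r \<in> rules G" and i: "i \<in> {1..n}" and pq: "p < m" "q < m"
  shows "rule_contrib l r (addr l' (i - 1) p q) = (if l = l' then case r of
      Binary i' j k \<Rightarrow> if i' = i then \<Sum>d<l. \<Sum>s<m. T d j p s * T (l - 1 - d) k s q else 0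
    | Terminal i' a \<Rightarrow> if i' = i \<and> l = 0 then trans A a $$ (p, q) else 0 else 0)"
proof (cases r)
  case (Binary i' j k)
  then have i': "i' \<in> {1..n}" using r chomsky by (fastforce simp: chomsky_cfg_def)
  \<comment> \<open>The intermediate state does not affect the target cell, so the indicator moves
    out of the innermost sum.\<close>
  have if_sum: "(\<Sum>s<m. if P then f s else 0) = (if P then \<Sum>s<m. f s else 0)" for P and f :: "nat \<Rightarrow> real"
    by simp
  have eq: "i - 1 = i' - 1 \<longleftrightarrow> i' = i" and less: "i - 1 < n" "i' - 1 < n" using i i' by auto
  show ?thesis
    unfolding Binary rule_contrib.simps if_sum sum_table_addr[OF less pq] eq by simp
next
  case (Terminal i' a)
  then have i': "i' \<in> {1..n}" using r chomsky by (fastforce simp: chomsky_cfg_def)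
  have eq: "i - 1 = i' - 1 \<longleftrightarrow> i' = i" and less: "i - 1 < n" "i' - 1 < n" using i i' by auto
  show ?thesis
    unfolding Terminal rule_contrib.simps sum_table_addr[OF less pq] eq by auto
qed

lemma sum_rules: "(\<Sum>r<length rs. f (rs ! r)) = (\<Sum>r \<in> rules G. f r)"
  using sum.reindex_bij_betw[OF bij_betw_nth[OF rs(1) refl refl], of f] rs(2) by simp

lemma layer_sum:
  assumes "i \<in> {1..n}" "p < m" "q < m"
  shows "(\<Sum>r<length rs. rule_contrib l (rs ! r) (addr l' (i - 1) p q)) =
    (if l = l' then T l i p q else 0)"
  unfolding sum_rules[of "\<lambda>r. rule_contrib l r (addr l' (i - 1) p q)"]
  using tree_weight_rec[OF chomsky hmm assms(2,3), of l i] rule_contrib_table[OF _ assms, of _ l l']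
  by (cases "l = l'") simp_all

text \<open>Table addresses start at 2, so cell 0 keeps its initial 0 until the output phase
  accumulates into it.\<close>

lemma rule_contrib_0: "rule_contrib l r 0 = 0"
  by (cases r) (simp_all add: table_addr_def)

lemma output_prog:
  "accumulates ns xs (filled L) [] output_prog
    (\<lambda>b. \<Sum>p<m. \<Sum>q<m. if b = 0 then init_dist A $ p * T (L - 1) (start G) p q else 0)
    (m * (m * 2))"
  unfolding output_prog_def
proof (intro accumulates_For)
  fix p q assume pq: "p < m" "q < m"
  show "accumulates ns xs (filled L) (([] @ [p]) @ [q]) (MulAdd (IConst 0) (RInput (reg 0))
     (RCell (table_exp (ISub word_length (IConst 1)) start_symbol (reg 0) (reg 1))))
     (\<lambda>b. if b = 0 then init_dist A $ p * T (L - 1) (start G) p q else 0) 2"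
  proof (rule accumulates_MulAdd)
    show "filled L (f(1 \<mapsto> u, 0 \<mapsto> z))" if "filled L f" for f u z
      using that by (auto simp: filled_def table_addr_def)
  qed (use pq start_bounds L_pos real_input_init[of p] in \<open>auto simp: registers_simps ival_table_exp
      filled_def dom_def set_eq_iff simp del: ival.simps(3)\<close>)
qed (simp_all del: ival.simps(3))

lemma init_prog:
  "\<exists>t. exec ns xs init_prog initial_state t \<and>
     rmem t = (\<lambda>a. if a < M then Some 0 else None) \<and> ops t = 0"
  unfolding init_prog_def
proof (rule For_rule[where N = M and
    Inv = "\<lambda>k s. rmem s = (\<lambda>a. if a < k then Some 0 else None) \<and> ops s = 0"])
  fix k and s :: state
  assume s: "rmem s = (\<lambda>a. if a < k then Some 0 else None) \<and> ops s = 0" "imem s 0 = k"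
  let ?t = "s\<lparr>rmem := (rmem s)(k \<mapsto> 0)\<rparr>"
  have "exec ns xs (RSet (reg 0) RZero) s ?t"
    using exec_RSet[of ns xs s RZero 0 "reg 0"] s by simp
  moreover have "rmem ?t = (\<lambda>a. if a < Suc k then Some 0 else None)"
    using s by (auto simp: fun_eq_iff)
  ultimately show "\<exists>t. exec ns xs (RSet (reg 0) RZero) s t \<and> imem t 0 = k \<and>
      rmem t = (\<lambda>a. if a < Suc k then Some 0 else None) \<and> ops t = 0"
    using s by (intro exI[of _ ?t]) simp
qed (simp_all add: initial_state_def fun_eq_iff del: ival.simps(3))

lemma table_prog:
  fixes s :: state
  assumes s: "rmem s = (\<lambda>a. if a < M then Some 0 else None)" "ops s = 0"
  shows "\<exists>t. exec ns xs (For 0 word_length layer_prog) s t \<and>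
    filled L (rmem t) \<and> rmem t 0 = Some 0 \<and> ops t \<le> L * (length rs * (2 * L * m ^ 3))"
proof -
  let ?K = "length rs * (2 * L * m ^ 3)"
  \<comment> \<open>\<open>filled k\<close> says nothing about the values in later layers. That they
    are still 0 must be carried along, since the program only adds to them.\<close>
  define Inv where "Inv k t \<longleftrightarrow> filled k (rmem t) \<and> rmem t 0 = Some 0 \<and> ops t \<le> k * ?K \<and>
    (\<forall>l\<in>{k..<L}. \<forall>i\<in>{1..n}. \<forall>p<m. \<forall>q<m. rmem t (addr l (i - 1) p q) = Some 0)" for k and t :: state
  have "\<exists>t. exec ns xs (For 0 word_length layer_prog) s t \<and> Inv L t"
  proof (rule For_rule)
    show "Inv 0 s"
      using s by (auto simp: Inv_def filled_def intro!: table_addr_less[of _ L _ n, simplified] split: if_splits)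
    show "\<exists>u. exec ns xs layer_prog t u \<and> imem u 0 = k \<and> Inv (Suc k) u"
      if k: "k < L" and t: "Inv k t" "imem t 0 = k" for k t
    proof -
      let ?g = "\<lambda>b. \<Sum>r<length rs. rule_contrib k (rs ! r) b"
      have "filled k (rmem t)" "registers [k] t" using t by (auto simp: Inv_def registers_simps)
      then obtain u where u: "exec ns xs layer_prog t u" "filled k (rmem u)" "registers [k] u"
        "\<And>a. a \<noteq> 1 \<Longrightarrow> rmem u a = map_option (\<lambda>x. x + ?g a) (rmem t a)" "ops u \<le> ops t + ?K"
        using layer_prog[OF k] unfolding accumulates_def by blast
      have new: "rmem u (addr l (i - 1) p q) = Some (if k = l then T k i p q else 0)"
        if "l \<in> {k..<L}" "i \<in> {1..n}" "p < m" "q < m" for l i p q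
      proof -
        have "addr l (i - 1) p q \<noteq> 1" by (simp add: table_addr_def)
        moreover have "rmem t (addr l (i - 1) p q) = Some 0" using t(1) that by (simp add: Inv_def)
        ultimately show ?thesis using u(4) layer_sum[OF that(2-4)] by simp
      qed
      have "filled (Suc k) (rmem u)"
        using u(2) new[of k] k by (auto simp: filled_def less_Suc_eq)
      moreover have "rmem u 0 = Some 0"
        using u(4)[of 0] t(1) by (simp add: Inv_def rule_contrib_0)
      moreover have "ops u \<le> Suc k * ?K" using u(5) t(1) by (simp add: Inv_def)
      moreover have "\<forall>l\<in>{Suc k..<L}. \<forall>i\<in>{1..n}. \<forall>p<m. \<forall>q<m. rmem u (addr l (i - 1) p q) = Some 0"
        using new by simp
      ultimately show ?thesis using u(1,3) by (auto simp: Inv_def registers_simps)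
    qed
  qed (simp_all add: Inv_def del: ival.simps(3))
  then show ?thesis by (auto simp: Inv_def)
qed

lemma inside_prog:
  "\<exists>t. exec ns xs inside_prog initial_state t \<and>
     rmem t 0 = Some (hmm_prob_set A (lang G \<inter> words \<Sigma> L)) \<and>
     ops t \<le> 4 * (cfg_size G * m ^ 2 * max (m * L ^ 2) (card \<Sigma>)) \<and>
     cells_used t \<le> 4 * (m ^ 2 * n * L)"
proof -
  obtain s where s: "exec ns xs init_prog initial_state s"
    "rmem s = (\<lambda>a. if a < M then Some 0 else None)" "ops s = 0"
    using init_prog by blast
  let ?result = "\<Sum>p<m. \<Sum>q<m. init_dist A $ p * T (L - 1) (start G) p q"
  have result: "hmm_prob_set A (lang G \<inter> words \<Sigma> L) = ?result"
    using hmm_prob_set_lang[OF chomsky unamb hmm, of "L - 1"] L_pos by simp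
  have "1 \<le> m ^ 2 * n * L" using states_pos start_bounds L_pos by (simp add: Suc_le_eq)
  moreover have "M = 2 + m ^ 2 * n * L" by (simp add: power2_eq_square mult_ac)
  ultimately have M: "M \<le> 4 * (m ^ 2 * n * L)" by linarith
  show ?thesis
  proof (cases "rs = []")
    case True
    \<comment> \<open>Without rules there are no trees, and the 0 that initialisation leaves in cell
      0 is already the answer.\<close>
    then have "T (L - 1) (start G) p q = 0" if "p < m" "q < m" for p q
      using tree_weight_rec[OF chomsky hmm that] rs by simp
    then have "?result = 0" by simp
    moreover have "dom (rmem s) = {..<M}" using s(2) by (auto split: if_splits)
    moreover have "exec ns xs inside_prog initial_state s"
      unfolding inside_prog_def
      by (intro exec_Seq[OF s(1)] exec_CondFalse exec_Skip) (simp add: True nat_input_def)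
    ultimately show ?thesis
      using s result M by (intro exI[of _ s]) (simp add: cells_used_def)
  next
    case False
    obtain t where t: "exec ns xs (For 0 word_length layer_prog) s t" "filled L (rmem t)"
      "rmem t 0 = Some 0" "ops t \<le> L * (length rs * (2 * L * m ^ 3))"
      using table_prog[OF s(2,3)] by blast
    obtain u where u: "exec ns xs output_prog t u" "filled L (rmem u)"
      "rmem u 0 = Some ?result" "ops u \<le> ops t + m * (m * 2)"
      using output_prog t(2,3) unfolding accumulates_def by (auto simp: registers_simps)
    have "exec ns xs inside_prog initial_state u"
      unfolding inside_prog_def using s(1) t(1) u(1) False
      by (intro exec_Seq exec_CondTrue) (simp_all del: ival.simps(3))
    moreover have "ops u \<le> 4 * (cfg_size G * m ^ 2 * max (m * L ^ 2) (card \<Sigma>))"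
    proof -
      have size: "cfg_size G = length rs"
        using rs distinct_card by (fastforce simp: cfg_size_def)
      \<comment> \<open>The output phase costs \<open>2 * m ^ 2\<close> for any grammar; a single
        rule is enough to absorb it. With the factor 2 of the table this makes 4.\<close>
      have "1 \<le> length rs * (m * L ^ 2)"
        using False states_pos L_pos by (simp add: Suc_le_eq)
      then have "m ^ 2 * 1 \<le> m ^ 2 * (length rs * (m * L ^ 2))" by (rule mult_le_mono2)
      moreover have "m ^ 2 * (length rs * (m * L ^ 2)) = length rs * m ^ 2 * (m * L ^ 2)"
        "m * (m * 2) = 2 * (m ^ 2 * 1)"
        "L * (length rs * (2 * L * m ^ 3)) = 2 * (length rs * m ^ 2 * (m * L ^ 2))"
        by (simp_all add: power2_eq_square power3_eq_cube mult_ac)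
      ultimately have "ops u \<le> 4 * (length rs * m ^ 2 * (m * L ^ 2))"
        using u(4) t(4) by linarith
      also have "\<dots> \<le> 4 * (length rs * m ^ 2 * max (m * L ^ 2) (card \<Sigma>))"
        by (intro mult_le_mono2) simp
      finally show ?thesis by (simp add: size)
    qed
    moreover have "cells_used u \<le> 4 * (m ^ 2 * n * L)"
      using u(2) M by (simp add: cells_used_def filled_def)
    ultimately show ?thesis using u(3) result by auto
  qed
qed


end

theorem mainTheorem3:
  shows "\<exists>(prog :: com) (C :: nat).
    \<forall>(\<Sigma> :: 'a set) (G :: 'a cfg) (A :: 'a hmm) (L :: nat) (as :: 'a list) (rs :: 'a rule list).
      finite \<Sigma> \<longrightarrow> chomsky_cfg \<Sigma> G \<longrightarrow> unambiguous G \<longrightarrow> hmm \<Sigma> A \<longrightarrow> L > 0 \<longrightarrow>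
      distinct as \<longrightarrow> set as = \<Sigma> \<longrightarrow> distinct rs \<longrightarrow> set rs = rules G \<longrightarrow>
      (\<exists>t. exec (nat_input as G rs A L) (real_input as A) prog initial_state t \<and>
           rmem t 0 = Some (hmm_prob_set A (lang G \<inter> words \<Sigma> L)) \<and>
           ops t \<le> C * (cfg_size G * states A ^ 2 * max (states A * L ^ 2) (card \<Sigma>)) \<and>
           cells_used t \<le> C * (states A ^ 2 * nonterms G * L))"
  \<comment> \<open>The program is one closed term that sees the instance only through its input
    lists, so it can be chosen before the instance; 4 serves for both bounds.\<close>
  by (intro exI[of _ inside_prog] exI[of _ 4] allI impI, rule inside_setting.inside_prog,
      unfold_locales)

end
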